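(* Let $X$ be a scalar (real-valued) random variable whose probability density is logarithmically concave, let $\eta\in[0,1]$ be a prescribed probability value, and let the distortion function be the squared error $\delta(x)=x^2$. Then a centered silence set minimizes the mean squared estimation error; that is, if $\mathscr{S}$ is a silence set with $\mathbb{P}[X\in\mathscr{S}]\ge\eta$ that is centered (with respect to $X$, $\eta$ and $\delta$), then $\mathscr{S}$ minimizes $$\mathbb{E}\left[\left(X-\widehat{X}_{\mathscr{A}}\right)^2 \,\middle|\, X\in\mathscr{A}\right]$$ over all silence sets $\mathscr{A}$ with $\mathbb{P}[X\in\mathscr{A}]\ge\eta$.
   Context: A silence set is a measurable set $\mathscr{A}\subseteq\mathbb{R}$. A density is logarithmically concave if its logarithm is a concave function over its support. For a silence set $\mathscr{A}$ the best estimate under silence is $\widehat{X}_{\mathscr{A}} = \arg\min_{y\in\mathbb{R}} \mathbb{E}[\delta(X-y)\mid X\in\mathscr{A}]$; for $\delta(x)=x^2$ this is $\widehat{X}_{\mathscr{A}}=\mathbb{E}[X\mid X\in\mathscr{A}]$. Centering: given a silence set $\mathscr{S}$, let $\alpha_\eta = \inf\{\alpha\ge 0 : \mathbb{P}[\delta(X-\widehat{X}_{\mathscr{S}})\le\alpha]\ge\eta\}$ and define the centering of $\mathscr{S}$ as $\mathscr{S}_{\mathrm{cen.}} = \{x\in\mathbb{R} : \delta(x-\widehat{X}_{\mathscr{S}})\le\alpha_\eta\}$, i.e. the smallest sub-level set of $\delta(\cdot-\widehat{X}_{\mathscr{S}})$ with probability mass no less than $\eta$. A set $\mathscr{S}$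 is called centered if it equals its centering or differs from it by a set of probability zero; the paper expresses this as $\mathbb{P}[X\in\mathscr{S}\setminus\mathscr{S}_{\mathrm{cen.}}]=0$. *)

theory Defs
  imports "HOL-Probability.Probability"
begin

definition log_concave_density :: "(real \<Rightarrow> real) \<Rightarrow> bool" where
  "log_concave_density f \<longleftrightarrow> concave_on {x. 0 < f x} (\<lambda>x. ln (f x))"
  (* concave_on includes convexity of its domain, here the support of f. *)

definition silence_set :: "real set \<Rightarrow> bool" where
  "silence_set A \<longleftrightarrow> A \<in> sets borel"

definition cond_distortion ::
  "'a measure \<Rightarrow> ('a \<Rightarrow> real) \<Rightarrow> (real \<Rightarrow> real) \<Rightarrow> real set \<Rightarrow> real \<Rightarrow> ennreal" where
  "cond_distortion M X \<delta> A y =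
     (\<integral>\<^sup>+ \<omega>. ennreal (\<delta> (X \<omega> - y)) \<partial>uniform_measure M {\<omega> \<in> space M. X \<omega> \<in> A})"
  (* E[delta (X - y) | X in A], for a nonnegative distortion delta: uniform_measure M E is M
     conditioned on E.  If E is a null set, uniform_measure M E is the zero measure, so
     the conditional expectation is then 0 for every y.  For a silence set of mass at least eta
     this can happen only when eta = 0. *)

definition best_estimate ::
  "'a measure \<Rightarrow> ('a \<Rightarrow> real) \<Rightarrow> (real \<Rightarrow> real) \<Rightarrow> real set \<Rightarrow> real" where
  "best_estimate M X \<delta> A = (ARG_MIN (cond_distortion M X \<delta> A) y. True)"

definition silence_error ::
  "'a measure \<Rightarrow> ('a \<Rightarrow> real) \<Rightarrow> (real \<Rightarrow> real) \<Rightarrow> real set \<Rightarrow> ennreal" where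
  "silence_error M X \<delta> A = cond_distortion M X \<delta> A (best_estimate M X \<delta> A)"

definition centering_level ::
  "'a measure \<Rightarrow> ('a \<Rightarrow> real) \<Rightarrow> (real \<Rightarrow> real) \<Rightarrow> real \<Rightarrow> real set \<Rightarrow> ereal" where
  "centering_level M X \<delta> \<eta> S =
     (INF \<alpha> \<in> {\<alpha>. 0 \<le> \<alpha> \<and> \<P>(\<omega> in M. \<delta> (X \<omega> - best_estimate M X \<delta> S) \<le> \<alpha>) \<ge> \<eta>}. ereal \<alpha>)"
  (* Extended-real, because for eta = 1 and X unbounded no finite level qualifies: the infimum
     is then infinite and the centering is the whole line. *)

definition centering ::
  "'a measure \<Rightarrow> ('a \<Rightarrow> real) \<Rightarrow> (real \<Rightarrow> real) \<Rightarrow> real \<Rightarrow> real set \<Rightarrow> real set" where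
  "centering M X \<delta> \<eta> S =
     {x. ereal (\<delta> (x - best_estimate M X \<delta> S)) \<le> centering_level M X \<delta> \<eta> S}"

definition centered ::
  "'a measure \<Rightarrow> ('a \<Rightarrow> real) \<Rightarrow> (real \<Rightarrow> real) \<Rightarrow> real \<Rightarrow> real set \<Rightarrow> bool" where
  "centered M X \<delta> \<eta> S \<longleftrightarrow> \<P>(\<omega> in M. X \<omega> \<in> S - centering M X \<delta> \<eta> S) = 0"
  (* One-sided, but if X has a density, delta is the square and S has mass at least eta, the
     centering has mass exactly eta, so this says that S and its centering agree up to a
     null set. *)

end

theory Submission
  imports Defs
begin

text \<open>
  Let \<open>0 < \<eta> < 1\<close>, and let \<open>c\<close> be the best estimate under the centered set \<open>S\<close>. The law of \<open>X\<close> has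
  no atoms, so \<open>S\<close> agrees up to a null set with an interval \<open>I = {c - r..c + r}\<close> of mass exactly \<open>\<eta>\<close>
  (\<open>square_sublevel_quantile\<close>), and as a minimiser of the squared error \<open>c\<close> is the conditional mean
  on \<open>I\<close>, that is, \<open>\<integral>\<^sub>I (x - c) f(x) dx = 0\<close> (\<open>best_estimate_square\<close>).

  Everything is compared through the function
  \<open>F a = \<integral> max 0 (r\<^sup>2 - (x - a)\<^sup>2) f(x) dx\<close>, with the radius \<open>r\<close> of \<open>I\<close> kept fixed; in terms of
  Lagrange duality, \<open>r\<^sup>2\<close> is the multiplier of the constraint that the mass be at least \<open>\<eta>\<close>. For a
  competitor \<open>A\<close> of mass \<open>p \<ge> \<eta>\<close> and any estimate \<open>y\<close>, the bump \<open>max 0 (r\<^sup>2 - (x - y)\<^sup>2)\<close> is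
  nonnegative and dominates \<open>r\<^sup>2 - (x - y)\<^sup>2\<close>, so \<open>r\<^sup>2 p - \<integral>\<^sub>A (x - y)\<^sup>2 f \<le> F y\<close>, while on \<open>I\<close> there is
  equality: \<open>F c = r\<^sup>2 \<eta> - \<integral>\<^sub>I (x - c)\<^sup>2 f\<close>. Once \<open>F y \<le> F c\<close> is known, dividing by the masses gives
  \<open>1/p \<integral>\<^sub>A (x - y)\<^sup>2 f \<ge> 1/\<eta> \<integral>\<^sub>I (x - c)\<^sup>2 f\<close> (\<open>conditional_second_moment_ge\<close>).

  That \<open>c\<close> maximises \<open>F\<close> is where log-concavity enters (\<open>parabolic_average_le\<close>). The derivative of \<open>F\<close>
  at \<open>s\<close> is twice the offset \<open>G s = \<integral> y f(s + y) dy\<close>, taken over \<open>{-r..r}\<close>. For \<open>s \<ge> c\<close> log-concavity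
  gives \<open>f(c) f(s + y) \<le> f(s) f(c + y)\<close> when \<open>y \<ge> 0\<close>, and the opposite inequality when \<open>y \<le> 0\<close>.
  Multiplying by \<open>y\<close> and integrating yields \<open>f(c) G s \<le> f(s) G c = 0\<close>; as \<open>f(c) > 0\<close>, the function
  \<open>F\<close> is nonincreasing to the right of \<open>c\<close>, and by reflection nondecreasing to the left.

  The two extreme values of \<open>\<eta>\<close> are degenerate: for \<open>\<eta> = 0\<close> the centering is a single point, so \<open>S\<close> is a
  null set with error \<open>0\<close>; for \<open>\<eta> = 1\<close> all admissible sets agree up to null sets.
\<close>

section \<open>Log-concave densities\<close>

text \<open>
  The points \<open>b\<close> and \<open>a + d - b\<close> divide the segment from \<open>a\<close> to \<open>d\<close> in complementary proportions, so
  adding the two concavity inequalities leaves \<open>ln (f a) + ln (f d)\<close> on the smaller side.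
\<close>

lemma log_concave_density_exchange:
  assumes lc: "log_concave_density f" and nn: "\<And>x. 0 \<le> f x"
    and "a \<le> b" "b \<le> d"
  shows "f a * f d \<le> f b * f (a + d - b)"
proof (cases "f a = 0 \<or> f d = 0 \<or> a = d")
  case True
  then show ?thesis using assms by (auto simp: mult.commute)
next
  case False
  define t where "t = (b - a) / (d - a)"
  have ad: "a < d" "0 < f a" "0 < f d"
    using False assms nn[of a] nn[of d] by (auto simp: less_le)
  have t: "0 \<le> t" "t \<le> 1" using ad assms by (auto simp: t_def)
  have "t * (d - a) = b - a" using ad by (simp add: t_def)
  then have b: "b = (1 - t) * a + t * d" and e: "a + d - b = (1 - (1 - t)) * a + (1 - t) * d"
    by (auto simp: algebra_simps)
  have cc: "concave_on {x. 0 < f x} (\<lambda>x. ln (f x))" using lc by (simp add: log_concave_density_def)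
  have cv: "convex {x. 0 < f x}" using cc by (simp add: concave_on_imp_convex)
  have pos: "0 < f ((1 - u) * a + u * d)" if "0 \<le> u" "u \<le> 1" for u
    using convexD[OF cv, of a d "1 - u" u] that ad by auto
  have ln_ge: "(1 - u) * ln (f a) + u * ln (f d) \<le> ln (f ((1 - u) * a + u * d))"
    if "0 \<le> u" "u \<le> 1" for u
    using concave_onD[OF cc that, of a d] ad by simp
  have fb: "0 < f b" "0 < f (a + d - b)" using pos[of t] pos[of "1 - t"] t unfolding b[symmetric] e[symmetric] by auto
  have "ln (f a) + ln (f d) \<le> ln (f b) + ln (f (a + d - b))"
    using ln_ge[of t] ln_ge[of "1 - t"] t unfolding b[symmetric] e[symmetric] by (simp add: algebra_simps)
  then have "ln (f a * f d) \<le> ln (f b * f (a + d - b))" using ad fb by (simp add: ln_mult)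
  then show ?thesis using ad fb by simp
qed

lemma log_concave_density_reflect:
  assumes "log_concave_density f"
  shows "log_concave_density (\<lambda>x. f (- x))"
proof -
  have cc: "concave_on {x. 0 < f x} (\<lambda>x. ln (f x))"
    using assms by (simp add: log_concave_density_def)
  have "convex (uminus ` {x. 0 < f x})"
    using cc by (intro convex_negations concave_on_imp_convex)
  moreover have "uminus ` {x. 0 < f x} = {x. 0 < f (- x)}"
    by (auto intro: image_eqI[of _ _ "- x" for x])
  ultimately have cv: "convex {x. 0 < f (- x)}" by simp
  show ?thesis
    unfolding log_concave_density_def concave_on_iff
  proof (intro conjI cv ballI allI impI)
    fix x y u v :: real
    assume "x \<in> {x. 0 < f (- x)}" "y \<in> {x. 0 < f (- x)}" "0 \<le> u" "0 \<le> v" "u + v = 1"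
    then have "u * ln (f (- x)) + v * ln (f (- y)) \<le> ln (f (u *\<^sub>R (- x) + v *\<^sub>R (- y)))"
      using cc unfolding concave_on_iff by blast
    then show "u * ln (f (- x)) + v * ln (f (- y)) \<le> ln (f (- (u *\<^sub>R x + v *\<^sub>R y)))"
      by simp
  qed
qed

lemma integrable_bounded_mult:
  fixes f h :: "real \<Rightarrow> real"
  assumes "integrable lborel f" "h \<in> borel_measurable borel" "\<And>x. \<bar>h x\<bar> \<le> B"
  shows "integrable lborel (\<lambda>x. h x * f x)"
proof (rule Bochner_Integration.integrable_bound)
  show "integrable lborel (\<lambda>x. B * f x)" using assms(1) by simp
  show "(\<lambda>x. h x * f x) \<in> borel_measurable lborel" using assms by measurable
  show "AE x in lborel. norm (h x * f x) \<le> norm (B * f x)"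
    using assms(3) by (auto simp: abs_mult intro!: mult_right_mono order_trans[OF assms(3)])
qed

text \<open>
  If \<open>f\<close> vanished at \<open>c\<close>, its convex support would lie on one side of \<open>c\<close>, and then
  \<open>(x - c) * f x\<close> could not integrate to zero over a window carrying positive mass.
\<close>

lemma log_concave_density_pos_at_center:
  assumes lc: "log_concave_density f" and nn: "\<And>x. 0 \<le> f x"
    and int: "integrable lborel f" and "0 \<le> r"
    and zero: "(\<integral>x. (indicator {c - r..c + r} x * (x - c)) * f x \<partial>lborel) = 0"
    and mass: "(\<integral>x. indicator {c - r..c + r} x * f x \<partial>lborel) > 0"
  shows "0 < f c"
proof (rule ccontr)
  assume "\<not> 0 < f c"
  then have c0: "f c = 0" using nn[of c] by simp
  have cv: "convex {x. 0 < f x}"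
    using lc by (auto simp: log_concave_density_def dest: concave_on_imp_convex)
  have side: "f a = 0 \<or> f b = 0" if "a < c" "c < b" for a b
  proof (rule ccontr)
    assume "\<not> ?thesis"
    then have "a \<in> {x. 0 < f x}" "b \<in> {x. 0 < f x}" using nn[of a] nn[of b] by auto
    then have "closed_segment a b \<subseteq> {x. 0 < f x}" using cv by (simp add: closed_segment_subset)
    moreover have "c \<in> closed_segment a b" using that by (auto simp: closed_segment_eq_real_ivl)
    ultimately show False using c0 by auto
  qed
  let ?h = "\<lambda>x. (indicator {c - r..c + r} x * (x - c)) * f x"
  have h_int: "integrable lborel ?h"
    using \<open>0 \<le> r\<close> by (intro integrable_bounded_mult[OF int, where B = r]) (auto simp: indicator_def)
  have "(\<forall>x. 0 \<le> ?h x) \<or> (\<forall>x. ?h x \<le> 0)"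
  proof (cases "\<exists>b>c. 0 < f b")
    case True
    then have "f a = 0" if "a < c" for a using side[OF that] by force
    then have "0 \<le> (x - c) * f x" for x using nn[of x] by (cases "x < c") auto
    then show ?thesis by (simp add: indicator_def)
  next
    case False
    then have "f b = 0" if "c < b" for b using nn[of b] that by (force simp: less_le)
    then have "(x - c) * f x \<le> 0" for x using nn[of x]
      by (cases "c < x") (auto simp: mult_nonpos_nonneg)
    then show ?thesis by (simp add: indicator_def)
  qed
  then have "AE x in lborel. ?h x = 0"
  proof
    assume "\<forall>x. 0 \<le> ?h x"
    then show ?thesis using integral_nonneg_eq_0_iff_AE[OF h_int] zero by auto
  next
    assume "\<forall>x. ?h x \<le> 0"
    then have "AE x in lborel. 0 \<le> - ?h x" by auto
    then show ?thesis using integral_nonneg_eq_0_iff_AE[of lborel "\<lambda>x. - ?h x"] h_int zero by auto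
  qed
  moreover have "AE x in lborel. x \<noteq> c" by (rule AE_lborel_singleton)
  ultimately have "AE x in lborel. indicator {c - r..c + r} x * f x = 0" by eventually_elim auto
  then have "(\<integral>x. indicator {c - r..c + r} x * f x \<partial>lborel) = 0" by (rule integral_eq_zero_AE)
  then show False using mass by simp
qed

section \<open>Averages against a parabolic bump\<close>

definition parabolic_bump :: "real \<Rightarrow> real \<Rightarrow> real" where
  "parabolic_bump r u = max 0 (r\<^sup>2 - u\<^sup>2)"

lemma parabolic_bump_measurable [measurable]: "parabolic_bump r \<in> borel_measurable borel"
  unfolding parabolic_bump_def by measurable

lemma parabolic_bump_bounds: "0 \<le> parabolic_bump r u" "parabolic_bump r u \<le> r\<^sup>2"
  by (auto simp: parabolic_bump_def)

lemma square_le_iff_in_interval: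
  fixes r :: real
  assumes "0 \<le> r"
  shows "(x - c)\<^sup>2 \<le> r\<^sup>2 \<longleftrightarrow> x \<in> {c - r..c + r}"
  using assms by (simp add: abs_le_square_iff[symmetric]) linarith

lemma parabolic_bump_eq_indicator:
  assumes "0 \<le> r"
  shows "parabolic_bump r (x - c)
    = r\<^sup>2 * indicator {c - r..c + r} x - indicator {c - r..c + r} x * (x - c)\<^sup>2"
  using square_le_iff_in_interval[OF assms, of x c]
  by (cases "x \<in> {c - r..c + r}") (auto simp: parabolic_bump_def max_def)

text \<open>
  Moving a window of fixed radius to the right multiplies the density seen from its centre by the
  nonincreasing factor \<open>f (s + y) / f (c + y)\<close>, which pushes the mean offset down.
  Comparing this factor with its value \<open>f s / f c\<close> at \<open>y = 0\<close> already gives the sign.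
\<close>

lemma window_offset_nonpos:
  assumes lc: "log_concave_density f" and nn: "\<And>x. 0 \<le> f x" and int: "integrable lborel f"
    and pos: "0 < f c" and "c \<le> s" and "0 \<le> r"
    and zero: "(\<integral>x. (indicator {c - r..c + r} x * (x - c)) * f x \<partial>lborel) = 0"
  shows "(\<integral>x. (indicator {s - r..s + r} x * (x - s)) * f x \<partial>lborel) \<le> 0"
proof -
  define h :: "real \<Rightarrow> real" where "h y = indicator {-r..r} y * y" for y
  have [measurable]: "h \<in> borel_measurable borel" unfolding h_def by measurable
  have shift: "(\<integral>x. (indicator {t - r..t + r} x * (x - t)) * f x \<partial>lborel) = (\<integral>y. h y * f (t + y) \<partial>lborel)" for t
    using lborel_integral_real_affine[of 1 "\<lambda>x. (indicator {t - r..t + r} x * (x - t)) * f x" t]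
    by (simp add: h_def indicator_def)
  have int_shift: "integrable lborel (\<lambda>y. h y * f (t + y))" for t
    using lborel_integrable_real_affine[OF int, of 1 t]
    by (intro integrable_bounded_mult[where B = r]) (auto simp: h_def indicator_def \<open>0 \<le> r\<close>)
  have "h y * (f c * f (s + y)) \<le> h y * (f s * f (c + y))" for y
  proof (cases "0 \<le> y")
    case True
    then have "f c * f (s + y) \<le> f s * f (c + y)"
      using log_concave_density_exchange[OF lc nn, of c s "s + y"] \<open>c \<le> s\<close> by simp
    then show ?thesis using True by (intro mult_left_mono) (auto simp: h_def)
  next
    case False
    then have "f s * f (c + y) \<le> f c * f (s + y)"
      using log_concave_density_exchange[OF lc nn, of "c + y" c s] \<open>c \<le> s\<close>
      by (simp add: mult.commute add.commute)
    then show ?thesis using False by (intro mult_left_mono_neg) (auto simp: h_def indicator_def)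
  qed
  then have "f c * (h y * f (s + y)) \<le> f s * (h y * f (c + y))" for y
    by (simp only: mult.left_commute[of "f c" "h y"] mult.left_commute[of "f s" "h y"])
  then have "(\<integral>y. f c * (h y * f (s + y)) \<partial>lborel) \<le> (\<integral>y. f s * (h y * f (c + y)) \<partial>lborel)"
    using int_shift by (intro integral_mono) auto
  also have "\<dots> = 0" using zero shift[of c] by simp
  finally show ?thesis using pos shift[of s] by (simp add: mult_le_0_iff)
qed

text \<open>
  The fundamental theorem of calculus in the centre variable; the bump has kinks at the two
  centres \<open>x - r\<close> and \<open>x + r\<close>, which the interior form of the theorem tolerates.
\<close>

lemma parabolic_bump_shift:
  assumes "c \<le> a" and "0 \<le> r"
  shows "parabolic_bump r (x - a) - parabolic_bump r (x - c)
    = 2 * (\<integral>s. indicator {c..a} s * (indicator {s - r..s + r} x * (x - s)) \<partial>lborel)"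
proof -
  define g where "g s = 2 * (indicator {s - r..s + r} x * (x - s))" for s
  have g: "g s = 2 * (indicator {x - r..x + r} s * (x - s))" for s by (auto simp: g_def indicator_def)
  have [measurable]: "g \<in> borel_measurable borel" unfolding g by measurable
  have der: "((\<lambda>s. parabolic_bump r (x - s)) has_vector_derivative g s) (at s)"
    if "s \<in> {c<..<a} - {x - r, x + r}" for s
  proof -
    have "s \<noteq> x - r" "s \<noteq> x + r" using that by auto
    then consider "s \<in> {x - r<..<x + r}" | "s \<in> {..<x - r} \<union> {x + r<..}"
      unfolding Un_iff greaterThanLessThan_iff lessThan_iff greaterThan_iff by linarith
    then show ?thesis
    proof cases
      case 1
      have "((\<lambda>s. r\<^sup>2 - (x - s)\<^sup>2) has_vector_derivative g s) (at s)"
        unfolding has_real_derivative_iff_has_vector_derivative[symmetric]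
        using 1 by (auto intro!: derivative_eq_intros simp: g)
      moreover have "parabolic_bump r (x - t) = r\<^sup>2 - (x - t)\<^sup>2" if "t \<in> {x - r<..<x + r}" for t
        using that abs_le_square_iff[of "x - t" r] by (auto simp: parabolic_bump_def)
      ultimately show ?thesis
        using 1 by (auto intro: has_vector_derivative_transform_within_open[of _ _ _ "{x - r<..<x + r}"])
    next
      case 2
      have "((\<lambda>s. 0) has_vector_derivative g s) (at s)" using 2 by (auto simp: g)
      moreover have "parabolic_bump r (x - t) = 0" if "t \<in> {..<x - r} \<union> {x + r<..}" for t
        using that \<open>0 \<le> r\<close> abs_le_square_iff[of r "x - t"] by (auto simp: parabolic_bump_def)
      ultimately show ?thesis
        using 2 by (auto intro!: has_vector_derivative_transform_within_open[of "\<lambda>s. 0" _ _ "{..<x - r} \<union> {x + r<..}"])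
    qed
  qed
  have "(g has_integral parabolic_bump r (x - a) - parabolic_bump r (x - c)) {c..a}"
    using der by (intro fundamental_theorem_of_calculus_interior_strong[where S = "{x - r, x + r}"])
      (auto simp: assms parabolic_bump_def intro!: continuous_intros)
  then have "integral {c..a} g = parabolic_bump r (x - a) - parabolic_bump r (x - c)" by (rule integral_unique)
  moreover have "set_integrable lborel {c..a} g"
    unfolding set_integrable_def
  proof (rule Bochner_Integration.integrable_bound)
    show "integrable lborel (\<lambda>s. indicator {c..a} s * (2 * r))"
      by (intro integrable_mult_left integrable_real_indicator) (auto simp: emeasure_lborel_Icc_eq)
  qed (auto simp: g indicator_def abs_mult)
  then have "(LINT s:{c..a}|lborel. g s) = integral {c..a} g" by (rule set_borel_integral_eq_integral)
  ultimately show ?thesis by (simp add: set_lebesgue_integral_def g_def mult.left_commute)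
qed

text \<open>
  Integrating \<open>parabolic_bump_shift\<close> over \<open>x\<close> and exchanging the integrals exhibits the difference of the two averages
  as an integral of window offsets, each of them nonpositive. This is the fundamental theorem of
  calculus for the average as a function of its centre, read off after the integration in \<open>x\<close>.
\<close>

lemma parabolic_average_le_right:
  assumes lc: "log_concave_density f" and nn: "\<And>x. 0 \<le> f x" and int: "integrable lborel f"
    and pos: "0 < f c" and "c \<le> a" and "0 \<le> r"
    and zero: "(\<integral>x. (indicator {c - r..c + r} x * (x - c)) * f x \<partial>lborel) = 0"
  shows "(\<integral>x. parabolic_bump r (x - a) * f x \<partial>lborel) \<le> (\<integral>x. parabolic_bump r (x - c) * f x \<partial>lborel)"
proof -
  have [measurable]: "f \<in> borel_measurable borel" using int by auto
  define h :: "real \<Rightarrow> real \<Rightarrow> real" where "h x s = indicator {s - r..s + r} x * (x - s)" for x s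
  have h_eq: "h x s = (if \<bar>x - s\<bar> \<le> r then x - s else 0)" for x s by (auto simp: h_def indicator_def)
  have h_bound: "\<bar>h x s\<bar> \<le> r" for x s using \<open>0 \<le> r\<close> by (simp add: h_eq)
  have [measurable]: "(\<lambda>(x, s). h x s) \<in> borel_measurable (borel \<Otimes>\<^sub>M borel)" unfolding h_eq by measurable
  have h_int: "integrable lborel (\<lambda>s. indicator {c..a} s * h x s)" for x
  proof (rule Bochner_Integration.integrable_bound)
    show "integrable lborel (\<lambda>s. indicator {c..a} s * r)"
      by (intro integrable_mult_left integrable_real_indicator) (auto simp: emeasure_lborel_Icc_eq)
  qed (use h_bound[of x] \<open>0 \<le> r\<close> in \<open>auto simp: abs_mult split: split_indicator\<close>)
  let ?H = "\<lambda>x s. indicator {c..a} s * h x s * f x"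
  have bump_int: "integrable lborel (\<lambda>x. parabolic_bump r (x - t) * f x)" for t
    using parabolic_bump_bounds[of r] by (intro integrable_bounded_mult[OF int, where B = "r\<^sup>2"]) auto
  have H_int: "integrable (lborel \<Otimes>\<^sub>M lborel) (\<lambda>(x, s). ?H x s)"
  proof (rule lborel_pair.Fubini_integrable)
    show "integrable lborel (\<lambda>x. \<integral>s. norm (case (x, s) of (x, s) \<Rightarrow> ?H x s) \<partial>lborel)"
    proof (rule Bochner_Integration.integrable_bound)
      show "integrable lborel (\<lambda>x. (a - c) * r * f x)" using int by simp
      show "AE x in lborel. norm (\<integral>s. norm (case (x, s) of (x, s) \<Rightarrow> ?H x s) \<partial>lborel) \<le> norm ((a - c) * r * f x)"
      proof (rule AE_I2)
        fix x
        have "(\<integral>s. norm (?H x s) \<partial>lborel) \<le> (\<integral>s. indicator {c..a} s * (r * f x) \<partial>lborel)"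
        proof (rule integral_mono)
          show "integrable lborel (\<lambda>s. norm (?H x s))"
            using h_int[of x] by (intro integrable_norm integrable_mult_left)
          show "integrable lborel (\<lambda>s. indicator {c..a} s * (r * f x))"
            by (intro integrable_mult_left integrable_real_indicator) (auto simp: emeasure_lborel_Icc_eq)
        qed (use h_bound[of x] nn[of x] in \<open>auto simp: indicator_def abs_mult intro!: mult_right_mono\<close>)
        also have "\<dots> = (a - c) * r * f x" using \<open>c \<le> a\<close> by simp
        finally show "norm (\<integral>s. norm (case (x, s) of (x, s) \<Rightarrow> ?H x s) \<partial>lborel) \<le> norm ((a - c) * r * f x)"
          using nn[of x] \<open>c \<le> a\<close> \<open>0 \<le> r\<close> by simp
      qed
    qed measurable
  qed (use h_int in auto)
  have "(\<integral>x. parabolic_bump r (x - a) * f x \<partial>lborel) - (\<integral>x. parabolic_bump r (x - c) * f x \<partial>lborel)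
      = (\<integral>x. (parabolic_bump r (x - a) - parabolic_bump r (x - c)) * f x \<partial>lborel)"
    using bump_int by (simp add: left_diff_distrib)
  also have "\<dots> = (\<integral>x. 2 * (\<integral>s. ?H x s \<partial>lborel) \<partial>lborel)"
    by (intro Bochner_Integration.integral_cong)
      (simp_all add: parabolic_bump_shift[OF \<open>c \<le> a\<close> \<open>0 \<le> r\<close>] h_def)
  also have "\<dots> = 2 * (\<integral>s. (\<integral>x. ?H x s \<partial>lborel) \<partial>lborel)"
    using lborel_pair.Fubini_integral[OF H_int] by simp
  also have "\<dots> \<le> 0"
  proof -
    have "(\<integral>x. ?H x s \<partial>lborel) \<le> 0" for s
      using window_offset_nonpos[OF lc nn int pos _ \<open>0 \<le> r\<close> zero, of s]
      by (cases "s \<in> {c..a}") (auto simp: h_def)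
    then have "0 \<le> (\<integral>s. - (\<integral>x. ?H x s \<partial>lborel) \<partial>lborel)" by (intro Bochner_Integration.integral_nonneg) auto
    then show ?thesis by simp
  qed
  finally show ?thesis by simp
qed

lemma parabolic_average_le:
  assumes lc: "log_concave_density f" and nn: "\<And>x. 0 \<le> f x" and int: "integrable lborel f"
    and pos: "0 < f c" and "0 \<le> r"
    and zero: "(\<integral>x. (indicator {c - r..c + r} x * (x - c)) * f x \<partial>lborel) = 0"
  shows "(\<integral>x. parabolic_bump r (x - a) * f x \<partial>lborel) \<le> (\<integral>x. parabolic_bump r (x - c) * f x \<partial>lborel)"
proof (cases "c \<le> a")
  case True
  then show ?thesis using parabolic_average_le_right assms by blast
next
  case False
  have reflect: "(\<integral>x. g x \<partial>lborel) = (\<integral>x. g (- x) \<partial>lborel)" for g :: "real \<Rightarrow> real"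
    using lborel_integral_real_affine[of "-1" g 0] by simp
  have bump_reflect: "parabolic_bump r (- x - t) = parabolic_bump r (x - (- t))" for x t
    by (simp add: parabolic_bump_def power2_eq_square algebra_simps)
  have "(\<integral>x. - ((indicator {- c - r..- c + r} x * (x - (- c))) * f (- x)) \<partial>lborel)
      = (\<integral>x. (indicator {c - r..c + r} (- x) * (- x - c)) * f (- x) \<partial>lborel)"
    by (rule Bochner_Integration.integral_cong) (auto simp: indicator_def algebra_simps)
  also have "\<dots> = 0" using zero by (subst (asm) reflect)
  finally have zero': "(\<integral>x. (indicator {- c - r..- c + r} x * (x - (- c))) * f (- x) \<partial>lborel) = 0"
    by simp
  have "integrable lborel (\<lambda>x. f (- x))" using lborel_integrable_real_affine[OF int, of "-1" 0] by simp
  then have "(\<integral>x. parabolic_bump r (x - (- a)) * f (- x) \<partial>lborel)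
      \<le> (\<integral>x. parabolic_bump r (x - (- c)) * f (- x) \<partial>lborel)"
    using False pos by (intro parabolic_average_le_right log_concave_density_reflect lc nn zero' \<open>0 \<le> r\<close>) auto
  then show ?thesis
    by (subst (1 2) reflect) (simp add: bump_reflect)
qed
section \<open>Conditional distortion and the best estimate\<close>

lemma cond_distortion_cong_AE:
  assumes "AE \<omega> in M. X \<omega> \<in> A \<longleftrightarrow> X \<omega> \<in> B"
    and [measurable]: "X \<in> borel_measurable M" "A \<in> sets borel" "B \<in> sets borel"
      "\<delta> \<in> borel_measurable borel"
  shows "cond_distortion M X \<delta> A = cond_distortion M X \<delta> B"
proof
  fix y
  let ?E = "\<lambda>C. {\<omega> \<in> space M. X \<omega> \<in> C}"
  have ae: "AE \<omega> in M. \<omega> \<in> ?E A \<longleftrightarrow> \<omega> \<in> ?E B" using assms(1) by eventually_elim auto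
  have "emeasure M (?E A) = emeasure M (?E B)" using ae by (intro emeasure_eq_AE) auto
  moreover have "(\<integral>\<^sup>+\<omega>. ennreal (\<delta> (X \<omega> - y)) * indicator (?E A) \<omega> \<partial>M)
      = (\<integral>\<^sup>+\<omega>. ennreal (\<delta> (X \<omega> - y)) * indicator (?E B) \<omega> \<partial>M)"
    using ae by (intro nn_integral_cong_AE) (auto simp: indicator_def elim!: eventually_mono)
  ultimately show "cond_distortion M X \<delta> A y = cond_distortion M X \<delta> B y"
    by (simp add: cond_distortion_def nn_integral_uniform_measure)
qed

lemma cond_distortion_eq_distr:
  assumes X: "X \<in> measurable M lborel" and [measurable]: "A \<in> sets borel" "\<delta> \<in> borel_measurable borel"
  shows "cond_distortion M X \<delta> A y =
    (\<integral>\<^sup>+x. ennreal (\<delta> (x - y)) * indicator A x \<partial>distr M lborel X) / emeasure (distr M lborel X) A"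
proof -
  have [measurable]: "X \<in> borel_measurable M" using X by simp
  have "{\<omega> \<in> space M. X \<omega> \<in> A} = X -` A \<inter> space M" by auto
  moreover have "(\<integral>\<^sup>+x. ennreal (\<delta> (x - y)) * indicator A x \<partial>distr M lborel X)
      = (\<integral>\<^sup>+\<omega>. ennreal (\<delta> (X \<omega> - y)) * indicator (X -` A \<inter> space M) \<omega> \<partial>M)"
    by (subst nn_integral_distr) (auto intro!: nn_integral_cong simp: indicator_def)
  ultimately show ?thesis
    unfolding cond_distortion_def by (simp add: nn_integral_uniform_measure emeasure_distr)
qed

text \<open>
  Weak duality: \<open>r\<^sup>2\<close> acts as the price of probability mass. A set heavier than \<open>\<eta>\<close> gains nothing
  from its excess \<open>p - \<eta>\<close>, because this excess contributes at least \<open>r\<^sup>2 * (p - \<eta>)\<close> to the second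
  moment and \<open>r\<^sup>2\<close> is no smaller than the claimed average \<open>V / \<eta>\<close>.
\<close>

lemma conditional_second_moment_ge:
  assumes "prob_space N" and sets_N [measurable_cong]: "sets N = sets borel"
    and A [measurable]: "A \<in> sets borel"
    and \<eta>: "0 < \<eta>" "\<eta> \<le> measure N A"
    and V: "V \<le> r\<^sup>2 * \<eta>"
    and bump: "(\<integral>x. parabolic_bump r (x - y) \<partial>N) \<le> r\<^sup>2 * \<eta> - V"
  shows "ennreal (V / \<eta>) \<le> (\<integral>\<^sup>+x. ennreal ((x - y)\<^sup>2) * indicator A x \<partial>N) / emeasure N A"
proof -
  interpret N: prob_space N by fact
  define p where "p = measure N A"
  have p: "0 < p" "\<eta> \<le> p" using \<eta> by (auto simp: p_def)
  have em: "emeasure N A = ennreal p" by (simp add: p_def N.emeasure_eq_measure)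
  have nn_eq: "(\<integral>\<^sup>+x. ennreal ((x - y)\<^sup>2) * indicator A x \<partial>N) = (\<integral>\<^sup>+x. ennreal (indicator A x * (x - y)\<^sup>2) \<partial>N)"
    by (auto intro!: nn_integral_cong simp: indicator_def)
  show ?thesis
  proof (cases "integrable N (\<lambda>x. indicator A x * (x - y)\<^sup>2)")
    case False
    then have "(\<integral>\<^sup>+x. ennreal (indicator A x * (x - y)\<^sup>2) \<partial>N) = \<infinity>"
      by (subst (asm) integrable_iff_bounded) (auto simp: less_top[symmetric])
    then show ?thesis using p by (simp add: nn_eq em ennreal_top_divide)
  next
    case True
    define W where "W = (\<integral>x. indicator A x * (x - y)\<^sup>2 \<partial>N)"
    have W: "(\<integral>\<^sup>+x. ennreal (indicator A x * (x - y)\<^sup>2) \<partial>N) = ennreal W"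
      unfolding W_def using True by (intro nn_integral_eq_integral) auto
    have ind: "integrable N (indicator A :: real \<Rightarrow> real)"
      by (intro integrable_real_indicator) (auto simp: em)
    have "r\<^sup>2 * p - W = (\<integral>x. r\<^sup>2 * indicator A x - indicator A x * (x - y)\<^sup>2 \<partial>N)"
      using True ind by (simp add: W_def p_def)
    also have "\<dots> \<le> (\<integral>x. parabolic_bump r (x - y) \<partial>N)"
    proof (rule integral_mono)
      show "integrable N (\<lambda>x. parabolic_bump r (x - y))"
        using parabolic_bump_bounds[of r] by (intro N.integrable_const_bound[where B = "r\<^sup>2"]) auto
    
      show "integrable N (\<lambda>x. r\<^sup>2 * indicator A x - indicator A x * (x - y)\<^sup>2)"
        using True ind by (intro Bochner_Integration.integrable_diff integrable_mult_right)
    qed (auto simp: parabolic_bump_def indicator_def)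
    finally have "r\<^sup>2 * p - W \<le> r\<^sup>2 * \<eta> - V" using bump by simp
    then have "(r\<^sup>2 * p - W) * \<eta> \<le> (r\<^sup>2 * \<eta> - V) * p"
      using V p \<eta> by (intro order_trans[OF mult_right_mono mult_left_mono]) auto
    then have "V / \<eta> \<le> W / p" using p \<eta> by (simp add: field_simps)
    then show ?thesis using p by (simp add: nn_eq em W divide_ennreal ennreal_leI W_def)
  qed
qed

text \<open>
  On a set of bounded values the squared error is a finite quadratic polynomial in the estimate, so
  its minimum is attained, at the conditional mean only. Hence the choice made by \<open>best_estimate\<close>
  is forced to be the mean.
\<close>

lemma best_estimate_square:
  assumes "prob_space M" and X [measurable]: "X \<in> measurable M lborel"
    and S [measurable]: "S \<in> sets borel" and N: "N = distr M lborel X"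
    and mass: "0 < measure N S"
    and bounded: "AE x in N. x \<in> S \<longrightarrow> \<bar>x\<bar> \<le> B"
    and b: "b = best_estimate M X (\<lambda>x. x\<^sup>2) S"
  shows "(\<integral>x. indicator S x * (x - b) \<partial>N) = 0"
    and "silence_error M X (\<lambda>x. x\<^sup>2) S = ennreal ((\<integral>x. indicator S x * (x - b)\<^sup>2 \<partial>N) / measure N S)"
proof -
  interpret M: prob_space M by fact
  interpret N: prob_space N unfolding N by (rule M.prob_space_distr) (rule X)
  have sets_N [measurable_cong]: "sets N = sets borel" by (simp add: N)
  define p where "p = measure N S"
  define D where "D y = (\<integral>x. indicator S x * (x - y)\<^sup>2 \<partial>N)" for y
  have p: "0 < p" using mass by (simp add: p_def)
  have em: "emeasure N S = ennreal p" by (simp add: p_def N.emeasure_eq_measure)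
  have int1: "integrable N (\<lambda>x. indicator S x * x)"
    using bounded by (intro N.integrable_const_bound[where B = "\<bar>B\<bar>"]) (auto simp: indicator_def elim!: eventually_mono)
  have int2: "integrable N (\<lambda>x. indicator S x * x\<^sup>2)"
    using bounded
    by (intro N.integrable_const_bound[where B = "B\<^sup>2"])
      (auto simp: indicator_def abs_le_square_iff[symmetric] elim!: eventually_mono)
  have expand: "indicator S x * (x - y)\<^sup>2 = indicator S x * x\<^sup>2 - 2 * y * (indicator S x * x) + y\<^sup>2 * indicator S x" for x y :: real
    by (simp add: power2_eq_square algebra_simps)
  define m where "m = (\<integral>x. indicator S x * x \<partial>N) / p"
  have ind: "integrable N (indicator S :: real \<Rightarrow> real)"
    by (intro integrable_real_indicator) (auto simp: em)
  have first: "(\<integral>x. indicator S x * x \<partial>N) = p * m" using p by (simp add: m_def)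
  have intD: "integrable N (\<lambda>x. indicator S x * (x - y)\<^sup>2)" for y
    unfolding expand using int1 int2 ind by auto
  have D_quadratic: "D y = (\<integral>x. indicator S x * x\<^sup>2 \<partial>N) - 2 * y * (p * m) + y\<^sup>2 * p" for y
    unfolding D_def expand using int1 int2 ind by (simp add: first p_def)
  \<comment> \<open>completing the square\<close>
  have D_eq: "D y = D m + p * (y - m)\<^sup>2" for y
    unfolding D_quadratic[of y] D_quadratic[of m] by (simp add: power2_eq_square algebra_simps)
  have D_nonneg: "0 \<le> D y" for y by (simp add: D_def)
  have cd: "cond_distortion M X (\<lambda>x. x\<^sup>2) S y = ennreal (D y / p)" for y
  proof -
    have "(\<integral>\<^sup>+x. ennreal ((x - y)\<^sup>2) * indicator S x \<partial>N) = (\<integral>\<^sup>+x. ennreal (indicator S x * (x - y)\<^sup>2) \<partial>N)"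
      by (auto intro!: nn_integral_cong simp: indicator_def)
    also have "\<dots> = ennreal (D y)" unfolding D_def by (intro nn_integral_eq_integral intD) auto
    finally show ?thesis
      using p by (simp add: cond_distortion_eq_distr[OF X S] N[symmetric] em divide_ennreal D_nonneg)
  qed
  have le_iff: "ennreal (D y / p) \<le> ennreal (D z / p) \<longleftrightarrow> D y \<le> D z" for y z
    using p by (simp add: D_nonneg divide_le_cancel)
  have "D m \<le> D y" for y using D_eq[of y] p by simp
  then have "is_arg_min (cond_distortion M X (\<lambda>x. x\<^sup>2) S) (\<lambda>_. True) m"
    by (simp add: is_arg_min_linorder cd le_iff)
  then have "is_arg_min (cond_distortion M X (\<lambda>x. x\<^sup>2) S) (\<lambda>_. True) b"
    unfolding b best_estimate_def arg_min_def by (rule someI)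
  then have "D b \<le> D m" by (simp add: is_arg_min_linorder cd le_iff)
  then have "b = m" using D_eq[of b] p by (simp add: mult_le_0_iff)
  have "(\<integral>x. indicator S x * (x - b) \<partial>N) = (\<integral>x. indicator S x * x - b * indicator S x \<partial>N)"
    by (simp add: algebra_simps)
  also have "\<dots> = 0" using int1 ind by (simp add: first \<open>b = m\<close> p_def)
  finally show "(\<integral>x. indicator S x * (x - b) \<partial>N) = 0" .
  show "silence_error M X (\<lambda>x. x\<^sup>2) S = ennreal ((\<integral>x. indicator S x * (x - b)\<^sup>2 \<partial>N) / measure N S)"
    by (simp add: silence_error_def b[symmetric] cd D_def p_def)
qed

lemma distributed_lborel_AE_neq:
  assumes dist: "distributed M lborel X g"
  shows "AE \<omega> in M. X \<omega> \<noteq> c"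
proof -
  have "g \<in> borel_measurable lborel" using dist by (simp add: distributed_def)
  then have "AE x in density lborel g. x \<noteq> c"
    using AE_lborel_singleton[of c] by (simp add: AE_density eventually_mono)
  then have "AE x in distr M lborel X. x \<noteq> c"
    by (simp only: distributed_distr_eq_density[OF dist])
  then show ?thesis by (rule AE_distrD[OF distributed_measurable[OF dist]])
qed

section \<open>The centering as an interval\<close>

text \<open>
  Since \<open>\<eta> < 1\<close>, some finite level has enough mass, so the infimum is a real number \<open>l\<close>. Every
  level below \<open>l\<close> has mass less than \<open>\<eta>\<close>; letting it increase to \<open>l\<close> bounds the mass of the open
  sub-level set by \<open>\<eta>\<close>, and without atoms its two end points add nothing.
\<close>

lemma square_sublevel_quantile:
  assumes "prob_space N" and sets_N [measurable_cong]: "sets N = sets borel"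
    and no_atoms: "\<And>x. measure N {x} = 0"
    and \<eta>: "0 < \<eta>" "\<eta> < 1"
  obtains r where "0 \<le> r" "measure N {b - r..b + r} \<le> \<eta>"
    "{x. ereal ((x - b)\<^sup>2) \<le> (INF \<alpha> \<in> {\<alpha>::real. 0 \<le> \<alpha> \<and> \<eta> \<le> measure N {x. (x - b)\<^sup>2 \<le> \<alpha>}}. ereal \<alpha>)} = {b - r..b + r}"
proof -
  interpret N: prob_space N by fact
  define Q where "Q = {\<alpha>::real. 0 \<le> \<alpha> \<and> \<eta> \<le> measure N {x. (x - b)\<^sup>2 \<le> \<alpha>}}"
  have space_N: "space N = UNIV" using sets_eq_imp_space_eq[OF sets_N] by simp
  have "(\<lambda>n. measure N {x. (x - b)\<^sup>2 \<le> real n}) \<longlonglongrightarrow> measure N (\<Union>n. {x. (x - b)\<^sup>2 \<le> real n})"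
    by (intro N.finite_Lim_measure_incseq) (auto simp: incseq_def intro: order_trans)
  moreover have "(\<Union>n. {x. (x - b)\<^sup>2 \<le> real n}) = space N" using real_arch_simple by (auto simp: space_N)
  ultimately have "\<forall>\<^sub>F n in sequentially. \<eta> < measure N {x. (x - b)\<^sup>2 \<le> real n}"
    using \<eta> by (intro order_tendstoD) (auto simp: N.prob_space)
  then obtain n :: nat where "\<eta> < measure N {x. (x - b)\<^sup>2 \<le> real n}" by (auto simp: eventually_sequentially)
  then have nQ: "real n \<in> Q" by (auto simp: Q_def)
  have bdd: "bdd_below Q" by (auto simp: Q_def intro: bdd_belowI[of _ 0])
  define l where "l = Inf Q"
  have "Q \<noteq> {}" using nQ by auto
  then have l: "0 \<le> l" unfolding l_def by (rule cInf_greatest) (simp add: Q_def)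
  have level: "(INF \<alpha>\<in>Q. ereal \<alpha>) = ereal l"
    unfolding l_def using ereal_Inf'[OF bdd \<open>Q \<noteq> {}\<close>] by simp
  \<comment> \<open>Below level \<open>l\<close>: negative levels give the empty set, the others fail to be in \<open>Q\<close>.\<close>
  define U where "U k = {x. (x - b)\<^sup>2 \<le> l - 1 / real (Suc k)}" for k
  have [measurable]: "U k \<in> sets borel" for k unfolding U_def by measurable
  have "measure N (U k) \<le> \<eta>" for k
  proof (cases "0 \<le> l - 1 / real (Suc k)")
    case True
    have "l - 1 / real (Suc k) \<notin> Q" using cInf_lower[OF _ bdd] unfolding l_def[symmetric] by force
    then show ?thesis using True by (simp add: Q_def U_def)
  next
    case False
    have "\<not> (x - b)\<^sup>2 \<le> l - 1 / real (Suc k)" for x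
      using False zero_le_power2[of "x - b"] by linarith
    then have "U k = {}" by (simp add: U_def)
    then show ?thesis using \<eta> by simp
  qed
  moreover have "incseq U"
  proof (intro monoI subsetI)
    fix j k x assume "j \<le> (k :: nat)" and "x \<in> U j"
    moreover have "1 / real (Suc k) \<le> 1 / real (Suc j)" using \<open>j \<le> k\<close> by (intro divide_left_mono) auto
    ultimately show "x \<in> U k" unfolding U_def by auto
  qed
  then have "(\<lambda>k. measure N (U k)) \<longlonglongrightarrow> measure N (\<Union>k. U k)"
    by (intro N.finite_Lim_measure_incseq) auto
  ultimately have "measure N (\<Union>k. U k) \<le> \<eta>" by (intro LIMSEQ_le_const2) auto
  moreover have "(\<Union>k. U k) = {x. (x - b)\<^sup>2 < l}"
  proof (intro set_eqI iffI)
    fix x assume "x \<in> (\<Union>k. U k)"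
    then obtain k where "(x - b)\<^sup>2 \<le> l - 1 / real (Suc k)" by (auto simp: U_def)
    moreover have "0 < 1 / real (Suc k)" by simp
    ultimately have "(x - b)\<^sup>2 < l" by linarith
    then show "x \<in> {x. (x - b)\<^sup>2 < l}" by simp
  next
    fix x assume "x \<in> {x. (x - b)\<^sup>2 < l}"
    then obtain k where "1 / real (Suc k) < l - (x - b)\<^sup>2" using nat_approx_posE[of "l - (x - b)\<^sup>2"] by auto
    then show "x \<in> (\<Union>k. U k)" by (auto simp: U_def intro!: exI[of _ k])
  qed
  ultimately have open_mass: "measure N {x. (x - b)\<^sup>2 < l} \<le> \<eta>" by simp
  define r where "r = sqrt l"
  have r: "0 \<le> r" "r\<^sup>2 = l" using l by (auto simp: r_def)
  have interval: "{x. (x - b)\<^sup>2 \<le> l} = {b - r..b + r}"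
    using r square_le_iff_in_interval[of r] by auto
  have "{b - r..b + r} \<subseteq> {x. (x - b)\<^sup>2 < l} \<union> ({b - r} \<union> {b + r})"
  proof
    fix x assume "x \<in> {b - r..b + r}"
    then have "(x - b)\<^sup>2 < r\<^sup>2 \<or> (x - b)\<^sup>2 = r\<^sup>2" unfolding interval[symmetric] r(2) by auto
    then show "x \<in> {x. (x - b)\<^sup>2 < l} \<union> ({b - r} \<union> {b + r})"
      unfolding r(2)[symmetric] power2_eq_iff by auto
  qed
  then have "measure N {b - r..b + r} \<le> measure N ({x. (x - b)\<^sup>2 < l} \<union> ({b - r} \<union> {b + r}))"
    by (intro N.finite_measure_mono) auto
  also have "\<dots> \<le> measure N {x. (x - b)\<^sup>2 < l} + (measure N {b - r} + measure N {b + r})"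
    by (intro order_trans[OF measure_Un_le] add_left_mono measure_Un_le) auto
  finally have "measure N {b - r..b + r} \<le> \<eta>" using open_mass by (simp add: no_atoms)
  moreover have "{x. ereal ((x - b)\<^sup>2) \<le> (INF \<alpha>\<in>Q. ereal \<alpha>)} = {b - r..b + r}"
    by (simp add: level interval)
  ultimately show ?thesis using that r(1) unfolding Q_def by blast
qed

section \<open>Optimality of centered sets\<close>

text \<open>
  The best estimate under the competitor \<open>A\<close> enters as one value of \<open>y\<close>. Quantifying over all \<open>y\<close>
  covers the case of an infinite second moment on \<open>A\<close>, where that estimate is an arbitrary choice.
\<close>

lemma silence_error_centered_le:
  fixes M :: "'a measure" and X :: "'a \<Rightarrow> real"
  assumes "prob_space M" and dist: "distributed M lborel X (\<lambda>x. ennreal (f x))"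
    and nn: "\<And>x. 0 \<le> f x" and lc: "log_concave_density f"
    and \<eta>: "0 < \<eta>" "\<eta> < 1"
    and S: "silence_set S" and S_mass: "\<P>(\<omega> in M. X \<omega> \<in> S) \<ge> \<eta>"
    and cen: "centered M X (\<lambda>x. x\<^sup>2) \<eta> S"
    and A: "silence_set A" and A_mass: "\<P>(\<omega> in M. X \<omega> \<in> A) \<ge> \<eta>"
  shows "silence_error M X (\<lambda>x. x\<^sup>2) S \<le> cond_distortion M X (\<lambda>x. x\<^sup>2) A y"
proof -
  interpret M: prob_space M by fact
  have X: "X \<in> measurable M lborel" using dist by (rule distributed_measurable)
  have [measurable]: "X \<in> borel_measurable M" using X by simp
  have f_meas [measurable]: "f \<in> borel_measurable borel" using distributed_real_measurable[OF _ dist] nn by simp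
  have [measurable]: "S \<in> sets borel" "A \<in> sets borel" using S A by (auto simp: silence_set_def)
  define N where "N = distr M lborel X"
  interpret N: prob_space N unfolding N_def by (rule M.prob_space_distr) (rule X)
  have sets_N [measurable_cong]: "sets N = sets borel" by (simp add: N_def)
  have space_N [simp]: "space N = UNIV" by (simp add: N_def)
  have N_density: "N = density lborel (\<lambda>x. ennreal (f x))" unfolding N_def using dist by (simp add: distributed_def)
  have prob_N: "\<P>(\<omega> in M. X \<omega> \<in> B) = measure N B" if "B \<in> sets borel" for B
    unfolding N_def using that X by (subst measure_distr) (auto simp: vimage_def Int_def conj_commute)
  have int_f: "integrable lborel f"
    using N.emeasure_space_1 nn by (intro integrableI_nonneg) (auto simp: N_density emeasure_density)
  have integral_N: "(\<integral>x. h x \<partial>N) = (\<integral>x. h x * f x \<partial>lborel)" if "h \<in> borel_measurable borel" for h :: "real \<Rightarrow> real"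
    unfolding N_density using that nn by (subst integral_density) (auto simp: mult.commute)
  have no_atoms: "measure N {x} = 0" for x
  proof -
    have "\<P>(\<omega> in M. X \<omega> = x) = 0"
      using distributed_lborel_AE_neq[OF dist, of x] by (subst M.prob_Collect_eq_0) auto
    then show ?thesis using prob_N[of "{x}"] by simp
  qed

  define c where "c = best_estimate M X (\<lambda>x. x\<^sup>2) S"
  have level: "centering_level M X (\<lambda>x. x\<^sup>2) \<eta> S
      = (INF \<alpha> \<in> {\<alpha>::real. 0 \<le> \<alpha> \<and> \<eta> \<le> measure N {x. (x - c)\<^sup>2 \<le> \<alpha>}}. ereal \<alpha>)"
    using prob_N[of "{x. (x - c)\<^sup>2 \<le> _}"] by (simp add: centering_level_def c_def[symmetric])
  obtain r where r: "0 \<le> r" and I_mass: "measure N {c - r..c + r} \<le> \<eta>"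
    and I: "centering M X (\<lambda>x. x\<^sup>2) \<eta> S = {c - r..c + r}"
    unfolding centering_def level c_def[symmetric]
    by (rule square_sublevel_quantile[OF N.prob_space_axioms sets_N no_atoms \<eta>, of c])
  let ?I = "{c - r..c + r}"
  \<comment> \<open>\<open>S\<close> is contained in \<open>?I\<close> up to a null set, and \<open>?I\<close> is no heavier than \<open>\<eta>\<close>: they must agree.\<close>
  have "measure N (S - ?I) = 0" using cen prob_N[of "S - ?I"] by (simp add: centered_def I)
  moreover have "measure N S \<ge> \<eta>" using S_mass prob_N[of S] by simp
  moreover have "measure N S = measure N (S - ?I) + measure N (S \<inter> ?I)"
    "measure N ?I = measure N (?I - S) + measure N (S \<inter> ?I)"
    by (simp_all add: N.finite_measure_Diff' Int_commute)
  moreover have "0 \<le> measure N (?I - S)" by simp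
  ultimately have null: "measure N (S - ?I) = 0" "measure N (?I - S) = 0"
    and mass: "measure N S = \<eta>" "measure N ?I = \<eta>" using I_mass by linarith+
  have "AE x in N. x \<notin> S - ?I" using null(1) by (subst (asm) N.prob_eq_0) auto
  moreover have "AE x in N. x \<notin> ?I - S" using null(2) by (subst (asm) N.prob_eq_0) auto
  ultimately have S_iff: "AE x in N. x \<in> S \<longleftrightarrow> x \<in> ?I"
    by eventually_elim blast
  have S_integral: "(\<integral>x. indicator S x * h x \<partial>N) = (\<integral>x. indicator ?I x * h x \<partial>N)"
    if [measurable]: "h \<in> borel_measurable borel" for h :: "real \<Rightarrow> real"
  proof (rule integral_cong_AE)
    show "AE x in N. indicator S x * h x = indicator ?I x * h x"
      using S_iff by eventually_elim (simp only: indicator_def)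
  qed measurable

  have "AE x in N. x \<in> S \<longrightarrow> \<bar>x\<bar> \<le> \<bar>c\<bar> + r"
    using S_iff by eventually_elim auto
  note estimate = best_estimate_square[OF \<open>prob_space M\<close> X _ N_def _ this c_def]
  define V where "V = (\<integral>x. indicator ?I x * (x - c)\<^sup>2 \<partial>N)"
  have "(\<integral>x. indicator S x * (x - c) \<partial>N) = 0" using estimate(1) mass \<eta> by simp
  moreover have "(\<integral>x. indicator S x * (x - c) \<partial>N) = (\<integral>x. indicator ?I x * (x - c) \<partial>N)"
    by (rule S_integral) measurable
  ultimately have zero: "(\<integral>x. (indicator ?I x * (x - c)) * f x \<partial>lborel) = 0" by (simp add: integral_N)
  have "(\<integral>x. indicator S x * (x - c)\<^sup>2 \<partial>N) = V"
    unfolding V_def by (rule S_integral) measurable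
  then have S_error: "silence_error M X (\<lambda>x. x\<^sup>2) S = ennreal (V / \<eta>)" using estimate(2) mass \<eta> by simp

  have "0 < f c"
  proof (rule log_concave_density_pos_at_center[OF lc nn int_f r zero])
    have "(\<integral>x. indicator ?I x * f x \<partial>lborel) = (\<integral>x. indicator ?I x \<partial>N)"
      by (rule integral_N[symmetric]) measurable
    also have "\<dots> = \<eta>" using mass by simp
    finally show "0 < (\<integral>x. indicator ?I x * f x \<partial>lborel)" using \<eta> by simp
  qed
  then have "(\<integral>x. parabolic_bump r (x - y) \<partial>N) \<le> (\<integral>x. parabolic_bump r (x - c) \<partial>N)"
    using parabolic_average_le[OF lc nn int_f _ r zero] by (simp add: integral_N)
  also have "\<dots> = (\<integral>x. r\<^sup>2 * indicator ?I x - indicator ?I x * (x - c)\<^sup>2 \<partial>N)"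
    by (simp only: parabolic_bump_eq_indicator[OF r])
  also have "\<dots> = r\<^sup>2 * \<eta> - V"
  proof -
    have "integrable N (\<lambda>x. indicator ?I x * (x - c)\<^sup>2)"
      using r by (intro N.integrable_const_bound[where B = "r\<^sup>2"])
        (auto simp: square_le_iff_in_interval split: split_indicator)
    moreover have "integrable N (indicator ?I :: real \<Rightarrow> real)"
      by (intro integrable_real_indicator) (auto simp: N.emeasure_eq_measure)
    ultimately show ?thesis using mass by (simp add: V_def)
  qed
  finally have bump: "(\<integral>x. parabolic_bump r (x - y) \<partial>N) \<le> r\<^sup>2 * \<eta> - V" .
  moreover have "0 \<le> (\<integral>x. parabolic_bump r (x - y) \<partial>N)" by (simp add: parabolic_bump_bounds)
  ultimately have "V \<le> r\<^sup>2 * \<eta>" by simp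
  then have "ennreal (V / \<eta>) \<le> (\<integral>\<^sup>+x. ennreal ((x - y)\<^sup>2) * indicator A x \<partial>N) / emeasure N A"
    using A_mass prob_N[of A] bump \<eta>
    by (intro conditional_second_moment_ge[OF N.prob_space_axioms sets_N]) auto
  also have "\<dots> = cond_distortion M X (\<lambda>x. x\<^sup>2) A y"
    unfolding N_def by (rule cond_distortion_eq_distr[OF X, symmetric]) auto
  finally show ?thesis using S_error by simp
qed

theorem corollary1p1:
  fixes M :: "'a measure" and X :: "'a \<Rightarrow> real" and f :: "real \<Rightarrow> real"
    and \<eta> :: real and S :: "real set"
  assumes "prob_space M"
    and "distributed M lborel X (\<lambda>x. ennreal (f x))"
    and "\<And>x. 0 \<le> f x"
    and "log_concave_density f"
    and "\<eta> \<in> {0..1}"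
    and "silence_set S"
    and "\<P>(\<omega> in M. X \<omega> \<in> S) \<ge> \<eta>"
    and "centered M X (\<lambda>x. x\<^sup>2) \<eta> S"
  shows "is_arg_min (silence_error M X (\<lambda>x. x\<^sup>2))
           (\<lambda>A. silence_set A \<and> \<P>(\<omega> in M. X \<omega> \<in> A) \<ge> \<eta>) S"
proof -
  interpret M: prob_space M by fact
  have X [measurable]: "X \<in> borel_measurable M" using distributed_measurable[OF assms(2)] by simp
  have sets [measurable]: "S \<in> sets borel" using assms(6) by (simp add: silence_set_def)
  have "silence_error M X (\<lambda>x. x\<^sup>2) S \<le> silence_error M X (\<lambda>x. x\<^sup>2) A"
    if A: "silence_set A" "\<P>(\<omega> in M. X \<omega> \<in> A) \<ge> \<eta>" for A
  proof -
    have [measurable]: "A \<in> sets borel" using A by (simp add: silence_set_def)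
    consider "\<eta> = 0" | "\<eta> = 1" | "0 < \<eta>" "\<eta> < 1" using assms(5) by fastforce
    then show ?thesis
    proof cases
      case 1
      define c where "c = best_estimate M X (\<lambda>x. x\<^sup>2) S"
      have "centering_level M X (\<lambda>x. x\<^sup>2) \<eta> S = ereal 0"
        unfolding centering_level_def
        by (intro antisym INF_lower INF_greatest) (auto simp: 1 zero_ereal_def[symmetric])
      then have "centering M X (\<lambda>x. x\<^sup>2) \<eta> S = {c}" by (auto simp: centering_def c_def)
      then have "AE \<omega> in M. X \<omega> \<notin> S - {c}"
        using assms(8) by (simp add: centered_def M.prob_Collect_eq_0)
      moreover have "AE \<omega> in M. X \<omega> \<noteq> c" by (rule distributed_lborel_AE_neq[OF assms(2)])
      ultimately have "AE \<omega> in M. X \<omega> \<in> S \<longleftrightarrow> X \<omega> \<in> {}" by eventually_elim auto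
      then have "cond_distortion M X (\<lambda>x. x\<^sup>2) S = cond_distortion M X (\<lambda>x. x\<^sup>2) {}"
        by (rule cond_distortion_cong_AE) auto
      moreover have "cond_distortion M X (\<lambda>x. x\<^sup>2) {} c = 0"
        by (simp add: cond_distortion_def nn_integral_uniform_measure)
      ultimately show ?thesis by (simp add: silence_error_def c_def)
    next
      case 2
      have "AE \<omega> in M. X \<omega> \<in> S" "AE \<omega> in M. X \<omega> \<in> A"
        using assms(7) A(2) 2 M.prob_Collect_eq_1[of "\<lambda>\<omega>. X \<omega> \<in> S"] M.prob_Collect_eq_1[of "\<lambda>\<omega>. X \<omega> \<in> A"]
          M.prob_le_1 by (auto intro: antisym)
      then have "AE \<omega> in M. X \<omega> \<in> S \<longleftrightarrow> X \<omega> \<in> A" by eventually_elim auto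
      then have "cond_distortion M X (\<lambda>x. x\<^sup>2) S = cond_distortion M X (\<lambda>x. x\<^sup>2) A"
        by (rule cond_distortion_cong_AE) auto
      then show ?thesis by (simp add: silence_error_def best_estimate_def)
    next
      case 3
      then show ?thesis
        unfolding silence_error_def[of M X _ A] using assms A
        by (intro silence_error_centered_le[of M X f \<eta> S A]) auto
    qed
  qed
  then show ?thesis using assms(6,7) by (simp add: is_arg_min_linorder)
qed

end
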